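(* Let $d=2k$ with $k\in\mathbb{N}_0$ and let $T\in\mathfrak{L}_d$, written as $T=\sum_{i=0}^{d}q_i(x)D^i$ with $q_i\in\mathbb{R}[x]$. The following are equivalent: (1) $T\in\mathfrak{L}_d(SOS)$; (2) $T_y\in\mathfrak{L}_d(SOS)$ for all $y\in\mathbb{R}$; (3) $\langle p_{y,d},f\rangle\ge 0$ for all $y\in\mathbb{R}$, $f\in SOS_d$, i.e., $p_{y,d}\in SOS_d^*$; (4) the Hankel matrix $\big((i+j)!\,q_{i+j}(y)\big)_{i,j=0}^{k}$ is positive semidefinite for all $y\in\mathbb{R}$.
   Context: $\mathbb{N}_0$ is the set of non-negative integers; $\mathbb{R}_d[x]=\{p\in\mathbb{R}[x]:\deg p\le d\}$; $D=\frac{d}{dx}$. $SOS=\{\sum_{i=1}^r p_i(x)^2: p_i\in\mathbb{R}[x],\ 1\le i\le r<\infty\}$ (equivalently, the set of $p\in\mathbb{R}[x]$ with $p(x)\ge 0$ for all $x\in\mathbb{R}$), and $SOS_d=SOS\cap\mathbb{R}_d[x]$. $\mathfrak{L}_d$ is the set of all linear operators $T:\mathbb{R}_d[x]\to\mathbb{R}[x]$, and $\mathfrak{L}_d(SOS)=\{T\in\mathfrak{L}_d:T(SOS_d)\subseteq SOS\}$. Any $T\in\mathfrak{L}_d$ may be written as $T=\sum_{i=0}^d q_i(x)D^i$ with $q_i\in\mathbb{R}[x]$. For $y\in\mathbb{R}$ define $$T_y=\sum_{i=0}^d q_i(y)D^i\in\mathfrak{L}_d,\qquad p_{y,d}(x)=\sum_{i=0}^d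 q_i(y)x^i\in\mathbb{R}_d[x].$$ The inner product on $\mathbb{R}[x]$ is the Fischer-Fock one: $\langle \sum_k a_kx^k,\sum_k b_kx^k\rangle=\sum_k k!\,a_kb_k$. For a cone $K\subseteq\mathbb{R}[x]$, $K^*=\{f\in\mathbb{R}[x]:\langle f,g\rangle\ge 0 \text{ for all } g\in K\}$. A real symmetric $N\times N$ matrix $A$ is positive semidefinite if $\mathbf{x}^tA\mathbf{x}\ge0$ for all $\mathbf{x}\in\mathbb{R}^N$. *)

theory Defs
  imports "HOL-Computational_Algebra.Polynomial" "Jordan_Normal_Form.Matrix"
begin

definition polys_upto :: "nat \<Rightarrow> real poly set" where
  "polys_upto d = {p. degree p \<le> d}"

definition SOS :: "real poly set" where
  "SOS = {p. \<exists>(r::nat) f. 1 \<le> r \<and> p = (\<Sum>i = 1..r. (f i)\<^sup>2)}"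

definition SOS_upto :: "nat \<Rightarrow> real poly set" where
  "SOS_upto d = SOS \<inter> polys_upto d"

(* A linear operator on the subspace of polynomials of degree at most d is represented by a total
   function that is linear on that subspace; its values elsewhere are irrelevant. *)
definition lin_ops :: "nat \<Rightarrow> (real poly \<Rightarrow> real poly) set" where
  "lin_ops d = {T. (\<forall>p \<in> polys_upto d. \<forall>r \<in> polys_upto d. T (p + r) = T p + T r) \<and>
                   (\<forall>c. \<forall>p \<in> polys_upto d. T (Polynomial.smult c p) = Polynomial.smult c (T p))}"

definition lin_ops_SOS :: "nat \<Rightarrow> (real poly \<Rightarrow> real poly) set" where
  "lin_ops_SOS d = {T \<in> lin_ops d. T ` SOS_upto d \<subseteq> SOS}"

definition diff_op :: "nat \<Rightarrow> (nat \<Rightarrow> real poly) \<Rightarrow> real poly \<Rightarrow> real poly" where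
  "diff_op d q p = (\<Sum>i\<le>d. q i * (pderiv ^^ i) p)"

(* The operator T_y, for T = diff_op d q: the coefficients are frozen at y. *)
definition diff_op_at :: "nat \<Rightarrow> (nat \<Rightarrow> real poly) \<Rightarrow> real \<Rightarrow> real poly \<Rightarrow> real poly" where
  "diff_op_at d q y = diff_op d (\<lambda>i. [:poly (q i) y:])"

(* The polynomial p_{y,d}. *)
definition symbol_at :: "nat \<Rightarrow> (nat \<Rightarrow> real poly) \<Rightarrow> real \<Rightarrow> real poly" where
  "symbol_at d q y = (\<Sum>i\<le>d. monom (poly (q i) y) i)"

definition fischer_inner :: "real poly \<Rightarrow> real poly \<Rightarrow> real" where
  "fischer_inner f g = (\<Sum>k\<le>max (degree f) (degree g). fact k * coeff f k * coeff g k)"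

definition dual_cone :: "real poly set \<Rightarrow> real poly set" where
  "dual_cone K = {f. \<forall>g\<in>K. fischer_inner f g \<ge> 0}"

definition pos_semidef :: "real mat \<Rightarrow> bool" where
  "pos_semidef A \<longleftrightarrow> square_mat A \<and> transpose_mat A = A \<and>
     (\<forall>x \<in> carrier_vec (dim_row A). x \<bullet> (A *\<^sub>v x) \<ge> 0)"

definition hankel_at :: "nat \<Rightarrow> (nat \<Rightarrow> real poly) \<Rightarrow> real \<Rightarrow> real mat" where
  "hankel_at k q y = mat (k + 1) (k + 1) (\<lambda>(i, j). fact (i + j) * poly (q (i + j)) y)"

end

theory Submission
  imports Defs "HOL-Computational_Algebra.Fundamental_Theorem_Algebra"
begin

text \<open>By Taylor's formula, \<open>(T p)(x)\<close> is the Fischer-Fock pairing of \<open>p\<^bsub>x,d\<^esub>\<close> with the translate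
  \<open>t \<mapsto> p(t + x)\<close>, and \<open>(T\<^sub>y p)(x)\<close> is the pairing of \<open>p\<^bsub>y,d\<^esub>\<close> with the same translate. Translations
  preserve the cone of sums of squares of degree at most \<open>d\<close>, and a univariate polynomial is a sum
  of squares once it is pointwise nonnegative; so (1), (2) and (3) all say that each pairing with
  \<open>p\<^bsub>y,d\<^esub>\<close> is nonnegative on that cone. Only squares \<open>g\<^sup>2\<close> with \<open>deg g \<le> k\<close> matter there, and the
  pairing with such a square is the quadratic form of the Hankel matrix at the coefficients of \<open>g\<close>.\<close>

section \<open>Minima and double roots of nonnegative polynomials\<close>

lemma poly_attains_min:
  fixes p :: "real poly"
  assumes "degree p \<noteq> 0" and nonneg: "\<And>x. poly p x \<ge> 0"
  shows "\<exists>a. \<forall>x. poly p a \<le> poly p x"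
proof -
  obtain c s where p: "p = pCons c s" by (cases p)
  have "s \<noteq> 0" using assms(1) p by auto
  \<comment> \<open>A nonconstant polynomial is unbounded at infinity, so outside a compact interval
    around 0 it stays above its value at 0. Since \<open>r\<close> may be negative, the interval is
    taken with endpoints given by the absolute value of \<open>r\<close>.\<close>
  then obtain r where "\<forall>z. r \<le> \<bar>z\<bar> \<longrightarrow> poly p 0 \<le> \<bar>poly p z\<bar>"
    using poly_infinity[of s "poly p 0" c] p by (metis real_norm_def)
  then have r: "poly p 0 \<le> poly p z" if "r \<le> \<bar>z\<bar>" for z
    using that nonneg[of z] by (metis abs_of_nonneg)
  obtain a where a: "\<And>x. - \<bar>r\<bar> \<le> x \<Longrightarrow> x \<le> \<bar>r\<bar> \<Longrightarrow> poly p a \<le> poly p x"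
    using isCont_eq_Lb[of "- \<bar>r\<bar>" "\<bar>r\<bar>" "poly p"] by fastforce
  have "poly p a \<le> poly p x" for x
  proof (cases "\<bar>x\<bar> \<le> \<bar>r\<bar>")
    case True
    then show ?thesis using a by (simp add: abs_le_iff)
  next
    case False
    then show ?thesis using a[of 0] r[of x] by linarith
  qed
  then show ?thesis by blast
qed

text \<open>A root of a nonnegative polynomial is a minimum, so the derivative vanishes there too
  and the linear factor splits off twice.\<close>

lemma double_root_at_zero_min:
  fixes p :: "real poly"
  assumes nonneg: "\<And>x. poly p x \<ge> 0" and root: "poly p a = 0"
  shows "\<exists>r. p = [:-a, 1:]\<^sup>2 * r \<and> (\<forall>x. poly r x \<ge> 0)"
proof -
  obtain s where s: "p = [:-a, 1:] * s" using root by (metis poly_eq_0_iff_dvd dvdE)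
  have "poly (pderiv p) a = 0"
    by (rule DERIV_local_min[OF poly_DERIV, of 1]) (use nonneg root in auto)
  then have "poly s a = 0" unfolding s pderiv_mult by (simp add: pderiv_pCons)
  then obtain r where "s = [:-a, 1:] * r" by (metis poly_eq_0_iff_dvd dvdE)
  then have p: "p = [:-a, 1:]\<^sup>2 * r" unfolding s power2_eq_square by (simp only: mult.assoc)
  have off: "poly r x \<ge> 0" if "x \<noteq> a" for x
  proof -
    have "poly p x = (x - a)\<^sup>2 * poly r x" by (simp add: p)
    then show ?thesis using nonneg[of x] that by (simp add: zero_le_mult_iff)
  qed
  \<comment> \<open>Dividing by the square says nothing at \<open>a\<close> itself; there the sign
    follows by continuity.\<close>
  have "poly r a \<ge> 0"
  proof (rule tendsto_lowerbound)
    show "(poly r \<longlongrightarrow> poly r a) (at a)" using poly_isCont isCont_def by blast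
    show "\<forall>\<^sub>F x in at a. 0 \<le> poly r x" by (auto simp: eventually_at_filter off)
  qed simp
  with off p show ?thesis by metis
qed

section \<open>Sums of squares\<close>

lemma square_in_SOS: "h\<^sup>2 \<in> SOS"
  unfolding SOS_def by (auto intro!: exI[of _ "1::nat"] exI[of _ "\<lambda>_. h"])

lemma SOS_add_square:
  assumes "p \<in> SOS"
  shows "p + h\<^sup>2 \<in> SOS"
proof -
  obtain r :: nat and f where "1 \<le> r" "p = (\<Sum>i = 1..r. (f i)\<^sup>2)"
    using assms unfolding SOS_def by blast
  then have "p + h\<^sup>2 = (\<Sum>i = 1..Suc r. ((f(Suc r := h)) i)\<^sup>2)" by simp
  moreover have "1 \<le> Suc r" by simp
  ultimately show ?thesis unfolding SOS_def by blast
qed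

lemma SOS_square_mult:
  assumes "p \<in> SOS"
  shows "h\<^sup>2 * p \<in> SOS"
proof -
  obtain r :: nat and f where "1 \<le> r" "p = (\<Sum>i = 1..r. (f i)\<^sup>2)"
    using assms unfolding SOS_def by blast
  then have "h\<^sup>2 * p = (\<Sum>i = 1..r. (h * f i)\<^sup>2)" by (simp add: sum_distrib_left power_mult_distrib)
  then show ?thesis using \<open>1 \<le> r\<close> unfolding SOS_def by auto
qed

lemma SOS_pcompose:
  assumes "p \<in> SOS"
  shows "p \<circ>\<^sub>p h \<in> SOS"
proof -
  obtain r :: nat and f where "1 \<le> r" "p = (\<Sum>i = 1..r. (f i)\<^sup>2)"
    using assms unfolding SOS_def by blast
  then have "p \<circ>\<^sub>p h = (\<Sum>i = 1..r. (f i \<circ>\<^sub>p h)\<^sup>2)"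
    by (simp add: pcompose_sum pcompose_mult power2_eq_square)
  then show ?thesis using \<open>1 \<le> r\<close> unfolding SOS_def by auto
qed

lemma SOS_nonneg: "p \<in> SOS \<Longrightarrow> poly p x \<ge> 0"
  by (auto simp: SOS_def poly_sum intro!: sum_nonneg)

text \<open>Subtracting the minimum value produces a double root, whose removal lowers the degree.\<close>

lemma nonneg_imp_SOS: "(\<And>x. poly p x \<ge> 0) \<Longrightarrow> p \<in> SOS"
proof (induction "degree p" arbitrary: p rule: less_induct)
  case less
  show ?case
  proof (cases "degree p = 0")
    case True
    then obtain c where p: "p = [:c:]" by (metis degree_eq_zeroE)
    with less.prems[of 0] have "p = [:sqrt c:]\<^sup>2" by (simp add: power2_eq_square)
    then show ?thesis using square_in_SOS by metis
  next
    case False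
    obtain a where a: "\<And>x. poly p a \<le> poly p x" using poly_attains_min[OF False less.prems] by auto
    obtain r where r: "p - [:poly p a:] = [:-a, 1:]\<^sup>2 * r" "\<And>x. poly r x \<ge> 0"
      using double_root_at_zero_min[of "p - [:poly p a:]" a] a by auto
    \<comment> \<open>The minimum value is itself nonnegative, so the subtracted constant is a
      square and can be added back.\<close>
    have c: "[:poly p a:] = [:sqrt (poly p a):]\<^sup>2" using less.prems[of a] by (simp add: power2_eq_square)
    have p: "p = [:-a, 1:]\<^sup>2 * r + [:sqrt (poly p a):]\<^sup>2" using r(1) c by (metis diff_add_cancel)
    have "r \<noteq> 0"
    proof
      assume "r = 0"
      then have "p = [:poly p a:]" using r(1) by simp
      then show False using False by (metis degree_pCons_0)
    qed
    have "degree (p - [:poly p a:]) \<le> degree p" by (simp add: degree_diff_le)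
    moreover have "degree (p - [:poly p a:]) = 2 + degree r"
      unfolding r(1) using \<open>r \<noteq> 0\<close> by (simp add: degree_mult_eq degree_power_eq)
    ultimately have "r \<in> SOS" using less.hyps[of r] r(2) by simp
    then show ?thesis by (subst p) (intro SOS_add_square SOS_square_mult)
  qed
qed

text \<open>Top-degree terms of real squares cannot cancel: if \<open>m\<close> is the largest
  degree of the \<open>f i\<close>, the coefficient of the sum at \<open>2 * m\<close> is a sum of
  squares of reals, not all zero.\<close>

lemma degree_sum_squares:
  fixes f :: "'b \<Rightarrow> real poly"
  assumes "finite A" "degree (\<Sum>i\<in>A. (f i)\<^sup>2) \<le> 2 * k" "i \<in> A"
  shows "degree (f i) \<le> k"
proof (rule ccontr)
  assume "\<not> degree (f i) \<le> k"
  define m where "m = Max ((\<lambda>i. degree (f i)) ` A)"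
  have le: "degree (f j) \<le> m" if "j \<in> A" for j using assms(1) that by (simp add: m_def)
  have "m > k" using le[OF assms(3)] \<open>\<not> degree (f i) \<le> k\<close> by simp
  have "m \<in> (\<lambda>i. degree (f i)) ` A" unfolding m_def using assms(1,3) by (intro Max_in) auto
  then obtain j where j: "j \<in> A" "degree (f j) = m" by auto
  have sq: "coeff ((f l)\<^sup>2) (2 * m) = (coeff (f l) m)\<^sup>2" if "l \<in> A" for l
  proof (cases "degree (f l) = m")
    case True
    then show ?thesis using coeff_mult_degree_sum[of "f l" "f l"]
      by (simp add: power2_eq_square mult_2)
  next
    case False
    with le[OF that] have "degree (f l) < m" by simp
    moreover from this have "degree ((f l)\<^sup>2) < 2 * m" using degree_power_le[of "f l" 2] by simp
    ultimately show ?thesis by (simp add: coeff_eq_0)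
  qed
  \<comment> \<open>Here \<open>m > k\<close> gives a positive degree, which excludes
    \<open>f j = 0\<close>.\<close>
  have "coeff (f j) m \<noteq> 0" using j \<open>m > k\<close> by (metis leading_coeff_0_iff degree_0 not_less0)
  then have "0 < (\<Sum>l\<in>A. (coeff (f l) m)\<^sup>2)" using j assms(1) by (intro sum_pos2) auto
  also have "\<dots> = coeff (\<Sum>i\<in>A. (f i)\<^sup>2) (2 * m)" by (simp add: coeff_sum sq)
  also have "\<dots> = 0" using assms(2) \<open>m > k\<close> by (intro coeff_eq_0) simp
  finally show False by simp
qed

section \<open>Taylor coefficients and the Fischer-Fock pairing\<close>

lemma higher_pderiv_translate:
  fixes p :: "real poly"
  shows "(pderiv ^^ i) (p \<circ>\<^sub>p [:a, 1:]) = (pderiv ^^ i) p \<circ>\<^sub>p [:a, 1:]"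
  by (induction i) (simp_all add: pderiv_pcompose pderiv_pCons)

text \<open>Differentiation commutes with translation, which moves the evaluation point to 0. The
  factorial that appears is exactly the weight of the Fischer-Fock product.\<close>

lemma poly_higher_pderiv_eq_coeff_translate:
  fixes p :: "real poly"
  shows "poly ((pderiv ^^ i) p) a = fact i * coeff (p \<circ>\<^sub>p [:a, 1:]) i"
proof -
  have "poly ((pderiv ^^ i) p) a = coeff ((pderiv ^^ i) (p \<circ>\<^sub>p [:a, 1:])) 0"
    by (simp add: higher_pderiv_translate poly_0_coeff_0[symmetric] poly_pcompose)
  then show ?thesis by (simp add: coeff_higher_pderiv pochhammer_fact)
qed

text \<open>A summation range independent of \<open>g\<close> makes linearity in \<open>g\<close>
  visible. The range is first enlarged past both degrees, then cut at \<open>d\<close>, beyond which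
  the symbol has no coefficients.\<close>

lemma fischer_inner_symbol_at:
  "fischer_inner (symbol_at d q y) g = (\<Sum>i\<le>d. fact i * poly (q i) y * coeff g i)"
proof -
  have coeff: "coeff (symbol_at d q y) i = (if i \<le> d then poly (q i) y else 0)" for i
    by (simp add: symbol_at_def coeff_sum)
  let ?h = "\<lambda>i. fact i * coeff (symbol_at d q y) i * coeff g i"
  let ?n = "max (degree (symbol_at d q y)) (degree g)"
  have "sum ?h {..?n} = sum ?h {..max ?n d}"
    by (rule sum.mono_neutral_left) (auto simp: coeff_eq_0)
  also have "\<dots> = sum ?h {..d}"
    by (rule sum.mono_neutral_right) (auto simp: coeff)
  finally show ?thesis by (simp add: fischer_inner_def coeff)
qed

lemma poly_diff_op:
  "poly (diff_op d q p) x = fischer_inner (symbol_at d q x) (p \<circ>\<^sub>p [:x, 1:])"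
  by (simp add: diff_op_def poly_sum fischer_inner_symbol_at
      poly_higher_pderiv_eq_coeff_translate mult_ac)

lemma poly_diff_op_at:
  "poly (diff_op_at d q y p) x = fischer_inner (symbol_at d q y) (p \<circ>\<^sub>p [:x, 1:])"
  by (simp add: diff_op_at_def poly_diff_op fischer_inner_symbol_at)

lemma smult_sum_right: "Polynomial.smult c (\<Sum>i\<in>A. f i) = (\<Sum>i\<in>A. Polynomial.smult c (f i))"
  by (induction A rule: infinite_finite_induct) (simp_all add: smult_add_right)

lemma diff_op_in_lin_ops: "diff_op d q \<in> lin_ops d"
  by (simp add: lin_ops_def diff_op_def higher_pderiv_add higher_pderiv_smult distrib_left
      sum.distrib smult_sum_right)

lemma translate_in_SOS_upto:
  assumes "p \<in> SOS_upto d"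
  shows "p \<circ>\<^sub>p [:a, 1:] \<in> SOS_upto d"
  using assms SOS_pcompose by (simp add: SOS_upto_def polys_upto_def degree_pcompose)

section \<open>Squares and the Hankel quadratic form\<close>

lemma fischer_inner_symbol_at_square:
  assumes "degree g \<le> k"
  shows "fischer_inner (symbol_at (2 * k) q y) (g\<^sup>2) =
    (\<Sum>i\<le>k. \<Sum>j\<le>k. fact (i + j) * poly (q (i + j)) y * (coeff g i * coeff g j))"
proof -
  let ?c = "\<lambda>n. fact n * poly (q n) y"
  have g: "g = (\<Sum>i\<le>k. monom (coeff g i) i)" using assms by (simp add: poly_as_sum_of_monoms')
  have "g\<^sup>2 = (\<Sum>i\<le>k. \<Sum>j\<le>k. monom (coeff g i * coeff g j) (i + j))"
    unfolding power2_eq_square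
    by (subst (1 2) g) (simp only: sum_product mult_monom)
  then have "coeff (g\<^sup>2) n = (\<Sum>i\<le>k. \<Sum>j\<le>k. if i + j = n then coeff g i * coeff g j else 0)" for n
    by (simp add: coeff_sum)
  then have "fischer_inner (symbol_at (2 * k) q y) (g\<^sup>2) =
    (\<Sum>n\<le>2 * k. \<Sum>i\<le>k. \<Sum>j\<le>k. if i + j = n then ?c n * (coeff g i * coeff g j) else 0)"
    by (simp add: fischer_inner_symbol_at sum_distrib_left if_distrib cong: if_cong)
  \<comment> \<open>With the sum over \<open>n\<close> innermost, only \<open>n = i + j\<close>
    survives, and it lies in the range because \<open>i\<close> and \<open>j\<close> are at most
    \<open>k\<close>.\<close>
  also have "\<dots> = (\<Sum>i\<le>k. \<Sum>j\<le>k. \<Sum>n\<le>2 * k. if i + j = n then ?c n * (coeff g i * coeff g j) else 0)"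
    by (subst sum.swap, rule sum.cong[OF refl], rule sum.swap)
  also have "\<dots> = (\<Sum>i\<le>k. \<Sum>j\<le>k. ?c (i + j) * (coeff g i * coeff g j))"
    by (intro sum.cong refl) auto
  finally show ?thesis .
qed

lemma hankel_at_quadratic_form:
  assumes "v \<in> carrier_vec (k + 1)"
  shows "v \<bullet> (hankel_at k q y *\<^sub>v v) =
    (\<Sum>i\<le>k. \<Sum>j\<le>k. fact (i + j) * poly (q (i + j)) y * (v $ i * v $ j))"
  using assms
  by (auto simp: hankel_at_def scalar_prod_def sum_distrib_left atLeast0LessThan
      lessThan_Suc_atMost mult_ac intro!: sum.cong)

text \<open>Vectors of length \<open>k + 1\<close> correspond to polynomials of degree at most
  \<open>k\<close> through their coefficients, so both sides test the same quadratic form.\<close>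

lemma pos_semidef_hankel_at_iff:
  "pos_semidef (hankel_at k q y) \<longleftrightarrow>
    (\<forall>g. degree g \<le> k \<longrightarrow> fischer_inner (symbol_at (2 * k) q y) (g\<^sup>2) \<ge> 0)"
proof -
  let ?Q = "\<lambda>u. \<Sum>i\<le>k. \<Sum>j\<le>k. fact (i + j) * poly (q (i + j)) y * (u i * u j)"
  have sym: "square_mat (hankel_at k q y)" "transpose_mat (hankel_at k q y) = hankel_at k q y"
    by (auto simp: hankel_at_def add.commute)
  have dim: "dim_row (hankel_at k q y) = k + 1" by (simp add: hankel_at_def)
  have "pos_semidef (hankel_at k q y) \<longleftrightarrow> (\<forall>v \<in> carrier_vec (k + 1). ?Q (\<lambda>i. v $ i) \<ge> 0)"
    unfolding pos_semidef_def dim using sym by (simp only: hankel_at_quadratic_form simp_thms cong: ball_cong)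
  also have "\<dots> \<longleftrightarrow> (\<forall>g. degree g \<le> k \<longrightarrow> ?Q (coeff g) \<ge> 0)"
  proof (intro iffI allI impI ballI)
    fix g :: "real poly"
    assume *: "\<forall>v \<in> carrier_vec (k + 1). ?Q (\<lambda>i. v $ i) \<ge> 0"
    have "0 \<le> ?Q (\<lambda>i. vec (k + 1) (coeff g) $ i)" by (rule bspec[OF *]) simp
    also have "\<dots> = ?Q (coeff g)" by (intro sum.cong) auto
    finally show "?Q (coeff g) \<ge> 0" .
  next
    fix v :: "real vec"
    assume *: "\<forall>g. degree g \<le> k \<longrightarrow> ?Q (coeff g) \<ge> 0"
    define g where "g = (\<Sum>i\<le>k. monom (v $ i) i)"
    have "degree g \<le> k" unfolding g_def
      by (intro degree_sum_le) (auto intro: order_trans[OF degree_monom_le])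
    then have "0 \<le> ?Q (coeff g)" by (rule *[rule_format])
    also have "\<dots> = ?Q (\<lambda>i. v $ i)"
      by (intro sum.cong refl) (auto simp: g_def coeff_sum)
    finally show "?Q (\<lambda>i. v $ i) \<ge> 0" .
  qed
  finally show ?thesis by (simp add: fischer_inner_symbol_at_square)
qed

text \<open>The pairing is additive in \<open>f\<close>, and \<open>degree_sum_squares\<close> keeps
  every summand of \<open>f\<close> within the squares tested on the right.\<close>

lemma nonneg_on_SOS_upto_iff_squares:
  "(\<forall>f \<in> SOS_upto (2 * k). fischer_inner (symbol_at d q y) f \<ge> 0) \<longleftrightarrow>
    (\<forall>g. degree g \<le> k \<longrightarrow> fischer_inner (symbol_at d q y) (g\<^sup>2) \<ge> 0)"
proof (intro iffI allI impI ballI)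
  fix g :: "real poly"
  assume *: "\<forall>f \<in> SOS_upto (2 * k). fischer_inner (symbol_at d q y) f \<ge> 0" and "degree g \<le> k"
  then have "g\<^sup>2 \<in> SOS_upto (2 * k)" using square_in_SOS degree_power_le[of g 2]
    by (simp add: SOS_upto_def polys_upto_def)
  with * show "fischer_inner (symbol_at d q y) (g\<^sup>2) \<ge> 0" by blast
next
  fix f
  assume *: "\<forall>g. degree g \<le> k \<longrightarrow> fischer_inner (symbol_at d q y) (g\<^sup>2) \<ge> 0"
    and f: "f \<in> SOS_upto (2 * k)"
  then obtain r :: nat and h where h: "f = (\<Sum>i = 1..r. (h i)\<^sup>2)" and "degree f \<le> 2 * k"
    unfolding SOS_upto_def SOS_def polys_upto_def by blast
  then have deg: "degree (h i) \<le> k" if "i \<in> {1..r}" for i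
    using degree_sum_squares[of "{1..r}" h k i] that by blast
  have "fischer_inner (symbol_at d q y) f = (\<Sum>i = 1..r. fischer_inner (symbol_at d q y) ((h i)\<^sup>2))"
    by (simp add: h fischer_inner_symbol_at coeff_sum sum_distrib_left) (rule sum.swap)
  also have "\<dots> \<ge> 0" using * deg by (intro sum_nonneg) blast
  finally show "fischer_inner (symbol_at d q y) f \<ge> 0" .
qed

section \<open>Operators preserving sums of squares\<close>

lemma preserves_SOS_iff_symbol_nonneg:
  assumes "T \<in> lin_ops d" and T: "\<forall>p \<in> polys_upto d. T p = diff_op d q p"
  shows "T \<in> lin_ops_SOS d \<longleftrightarrow>
    (\<forall>y. \<forall>f \<in> SOS_upto d. fischer_inner (symbol_at d q y) f \<ge> 0)"
proof (intro iffI allI ballI)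
  fix y f
  assume "T \<in> lin_ops_SOS d" and f: "f \<in> SOS_upto d"
  \<comment> \<open>Evaluating at \<open>y\<close> pairs the symbol with the translate by
    \<open>y\<close>; translating \<open>f\<close> back beforehand makes that translate equal to
    \<open>f\<close>.\<close>
  let ?g = "f \<circ>\<^sub>p [:-y, 1:]"
  have g: "?g \<in> SOS_upto d" by (rule translate_in_SOS_upto[OF f])
  have "0 \<le> poly (T ?g) y"
    using \<open>T \<in> lin_ops_SOS d\<close> g by (intro SOS_nonneg) (auto simp: lin_ops_SOS_def)
  also have "T ?g = diff_op d q ?g" using T g by (auto simp: SOS_upto_def)
  also have "poly \<dots> y = fischer_inner (symbol_at d q y) f"
    by (simp add: poly_diff_op pcompose_assoc[symmetric] pcompose_pCons)
  finally show "fischer_inner (symbol_at d q y) f \<ge> 0" .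
next
  assume *: "\<forall>y. \<forall>f \<in> SOS_upto d. fischer_inner (symbol_at d q y) f \<ge> 0"
  have "T p \<in> SOS" if "p \<in> SOS_upto d" for p
  proof (rule nonneg_imp_SOS)
    fix x
    have "T p = diff_op d q p" using T that by (auto simp: SOS_upto_def)
    then show "0 \<le> poly (T p) x" using * translate_in_SOS_upto[OF that] by (simp add: poly_diff_op)
  qed
  with assms(1) show "T \<in> lin_ops_SOS d" by (auto simp: lin_ops_SOS_def)
qed

text \<open>This is the previous equivalence for constant coefficients: their symbol is the same at
  every point, so the quantifier over points collapses to the single frozen
  \<open>y\<close>.\<close>

lemma diff_op_at_preserves_SOS_iff:
  "diff_op_at d q y \<in> lin_ops_SOS d \<longleftrightarrow>
    (\<forall>f \<in> SOS_upto d. fischer_inner (symbol_at d q y) f \<ge> 0)"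
proof -
  have "symbol_at d (\<lambda>i. [:poly (q i) y:]) z = symbol_at d q y" for z by (simp add: symbol_at_def)
  then show ?thesis
    using preserves_SOS_iff_symbol_nonneg[of "diff_op_at d q y" d "\<lambda>i. [:poly (q i) y:]"]
    by (simp add: diff_op_at_def diff_op_in_lin_ops)
qed

theorem theorem2p3:
  fixes d k :: nat and T :: "real poly \<Rightarrow> real poly" and q :: "nat \<Rightarrow> real poly"
  assumes "d = 2 * k"
    and "T \<in> lin_ops d"
    and "\<forall>p \<in> polys_upto d. T p = diff_op d q p"
  shows "(T \<in> lin_ops_SOS d \<longleftrightarrow> (\<forall>y. diff_op_at d q y \<in> lin_ops_SOS d))
    \<and> ((\<forall>y. diff_op_at d q y \<in> lin_ops_SOS d) \<longleftrightarrow>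
         (\<forall>y. \<forall>f \<in> SOS_upto d. fischer_inner (symbol_at d q y) f \<ge> 0))
    \<and> ((\<forall>y. \<forall>f \<in> SOS_upto d. fischer_inner (symbol_at d q y) f \<ge> 0) \<longleftrightarrow>
         (\<forall>y. symbol_at d q y \<in> dual_cone (SOS_upto d)))
    \<and> ((\<forall>y. symbol_at d q y \<in> dual_cone (SOS_upto d)) \<longleftrightarrow>
         (\<forall>y. pos_semidef (hankel_at k q y)))"
proof -
  have dual: "symbol_at d q y \<in> dual_cone (SOS_upto d) \<longleftrightarrow>
      (\<forall>f \<in> SOS_upto d. fischer_inner (symbol_at d q y) f \<ge> 0)" for y
    by (simp add: dual_cone_def)
  have hankel: "pos_semidef (hankel_at k q y) \<longleftrightarrow>
      (\<forall>f \<in> SOS_upto d. fischer_inner (symbol_at d q y) f \<ge> 0)" for y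
    unfolding assms(1) pos_semidef_hankel_at_iff nonneg_on_SOS_upto_iff_squares ..
  show ?thesis
    using preserves_SOS_iff_symbol_nonneg[OF assms(2,3)]
    by (simp add: diff_op_at_preserves_SOS_iff dual hankel)
qed

end
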